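(* Let $W \in \mathbb{R}^{n\times n}$ be a symmetric indefinite matrix and let $T \in \mathbb{R}^{n\times n}$ be symmetric positive definite. Let $\alpha > 0$ and $\gamma > 0$. Suppose that for every $x \in \mathbb{C}^n$ with $\|x\|_2 = 1$, $$\alpha > \frac{b-c}{2}, \qquad\text{where } c = x^{*}Tx > 0,\quad b = x^{*}WT^{-1}Wx \ge 0 .$$ Then, for every right-hand side $\mathbf{d}\in\mathbb{R}^{2n}$ and every initial guess $\mathbf{u}^{(0)} \in \mathbb{R}^{2n}$, the VBP iteration $$\mathscr{P}_{\mathrm{VBP}}\,\mathbf{u}^{(k+1)} = \mathscr{R}_{\mathrm{VBP}}\,\mathbf{u}^{(k)} + \mathbf{d},\qquad k=0,1,2,\dots,$$ converges to the unique solution $\mathbf{u}\in\mathbb{R}^{2n}$ of $\mathscr{A}\mathbf{u} = \mathbf{d}$.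
   Context: A real symmetric matrix is indefinite if it has both positive and negative eigenvalues. $x^{*}$ is the conjugate transpose of $x$ and $\|\cdot\|_2$ the Euclidean norm. For real $n\times n$ matrices $W,T$ and real parameters $\alpha,\gamma$, define the $2n\times 2n$ real block matrices $$\mathscr{A} = \begin{bmatrix} T & -W\\ W & T\end{bmatrix},\qquad \mathscr{P}_{\mathrm{VBP}} = \begin{bmatrix} T+\alpha I & -\gamma W\\ 0 & I\end{bmatrix}\begin{bmatrix} I & 0\\ W & T\end{bmatrix} = \begin{bmatrix} T+\alpha I-\gamma W^2 & -\gamma WT\\ W & T\end{bmatrix},$$ $$\mathscr{R}_{\mathrm{VBP}} = \mathscr{P}_{\mathrm{VBP}} - \mathscr{A} = \begin{bmatrix} \alpha I-\gamma W^2 & W-\gamma WT\\ 0 & 0\end{bmatrix}.$$ *)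

theory Defs
  imports "HOL-Analysis.Analysis"
begin

definition symmetric_matrix :: "real^'n^'n \<Rightarrow> bool" where
  "symmetric_matrix A \<longleftrightarrow> transpose A = A"

definition is_eigenvalue :: "real^'n^'n \<Rightarrow> real \<Rightarrow> bool" where
  "is_eigenvalue A l \<longleftrightarrow> (\<exists>v. v \<noteq> 0 \<and> A *v v = l *\<^sub>R v)"

text \<open>
  The eigenvalues of a real symmetric matrix are real and have real eigenvectors, so
  real eigenvalues suffice here.
\<close>

definition symmetric_indefinite :: "real^'n^'n \<Rightarrow> bool" where
  "symmetric_indefinite A \<longleftrightarrow>
     symmetric_matrix A \<and> (\<exists>l>0. is_eigenvalue A l) \<and> (\<exists>l<0. is_eigenvalue A l)"

definition symmetric_pos_def :: "real^'n^'n \<Rightarrow> bool" where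
  "symmetric_pos_def A \<longleftrightarrow> symmetric_matrix A \<and> (\<forall>x. x \<noteq> 0 \<longrightarrow> x \<bullet> (A *v x) > 0)"

text \<open>The complex number \<open>x\<^sup>* A x\<close>, for a real matrix \<open>A\<close> and a complex vector \<open>x\<close>.\<close>

definition herm_form :: "real^'n^'n \<Rightarrow> complex^'n \<Rightarrow> complex" where
  "herm_form A x = (\<Sum>i\<in>UNIV. cnj (x $ i) * (map_matrix complex_of_real A *v x) $ i)"

text \<open>
  For symmetric \<open>A\<close> this number is real, and it is positive (nonnegative) on nonzero
  vectors if \<open>A\<close> is positive definite (semidefinite). Taking its real part therefore
  loses nothing.
\<close>

lemma herm_form_symmetric:
  fixes A :: "real^'n^'n" and x :: "complex^'n"
  assumes "symmetric_matrix A"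
  defines "u \<equiv> \<chi> i. Re (x $ i)" and "v \<equiv> \<chi> i. Im (x $ i)"
  shows "herm_form A x = complex_of_real (u \<bullet> (A *v u) + v \<bullet> (A *v v))"
proof -
  have sym: "A $ i $ j = A $ j $ i" for i j
    using assms(1) unfolding symmetric_matrix_def transpose_def by (metis vec_lambda_beta)
  have "(\<Sum>i\<in>UNIV. \<Sum>j\<in>UNIV. Re (x $ i) * (A $ i $ j * Im (x $ j))) =
        (\<Sum>i\<in>UNIV. \<Sum>j\<in>UNIV. Im (x $ i) * (A $ i $ j * Re (x $ j)))"
    by (subst sum.swap) (intro sum.cong refl, metis sym mult.commute mult.left_commute)
  then show ?thesis
    unfolding u_def v_def herm_form_def matrix_vector_mult_def inner_vec_def
    by (intro complex_eqI)
       (simp_all add: sum.distrib sum_subtractf sum_distrib_left sum_negf algebra_simps)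
qed

lemma herm_form_pos:
  assumes "symmetric_pos_def A" "x \<noteq> 0"
  shows "herm_form A x \<in> \<real>" "Re (herm_form A x) > 0"
proof -
  define u v where "u = (\<chi> i. Re (x $ i))" and "v = (\<chi> i. Im (x $ i))"
  have A: "symmetric_matrix A" "\<And>y. y \<noteq> 0 \<Longrightarrow> y \<bullet> (A *v y) > 0"
    using assms(1) by (auto simp: symmetric_pos_def_def)
  have eq: "herm_form A x = complex_of_real (u \<bullet> (A *v u) + v \<bullet> (A *v v))"
    unfolding u_def v_def by (rule herm_form_symmetric[OF A(1)])
  have nn: "y \<bullet> (A *v y) \<ge> 0" for y
    using A(2)[of y] by (cases "y = 0") auto
  have "u \<noteq> 0 \<or> v \<noteq> 0"
    using assms(2) by (auto simp: u_def v_def vec_eq_iff complex_eq_iff)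
  then show "Re (herm_form A x) > 0"
    unfolding eq using A(2) nn by (auto intro: add_pos_nonneg add_nonneg_pos)
  show "herm_form A x \<in> \<real>" unfolding eq by simp
qed

text \<open>
  The index type \<open>'n + 'n\<close> has \<open>2n\<close> elements; \<open>Inl\<close> indexes the first
  block row or column and \<open>Inr\<close> the second one.
\<close>

definition block_matrix ::
  "'a^'n^'m \<Rightarrow> 'a^'k^'m \<Rightarrow> 'a^'n^'l \<Rightarrow> 'a^'k^'l \<Rightarrow> 'a^('n + 'k)^('m + 'l)" where
  "block_matrix A B C D =
     (\<chi> i j. case i of
        Inl p \<Rightarrow> (case j of Inl q \<Rightarrow> A $ p $ q | Inr q \<Rightarrow> B $ p $ q)
      | Inr p \<Rightarrow> (case j of Inl q \<Rightarrow> C $ p $ q | Inr q \<Rightarrow> D $ p $ q))"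

definition system_matrix :: "real^'n^'n \<Rightarrow> real^'n^'n \<Rightarrow> real^('n + 'n)^('n + 'n)" where
  "system_matrix W T = block_matrix T (- W) W T"

definition P_VBP ::
  "real^'n^'n \<Rightarrow> real^'n^'n \<Rightarrow> real \<Rightarrow> real \<Rightarrow> real^('n + 'n)^('n + 'n)" where
  "P_VBP W T \<alpha> \<gamma> =
     block_matrix (T + \<alpha> *\<^sub>R mat 1) (- (\<gamma> *\<^sub>R W)) 0 (mat 1) ** block_matrix (mat 1) 0 W T"

definition R_VBP ::
  "real^'n^'n \<Rightarrow> real^'n^'n \<Rightarrow> real \<Rightarrow> real \<Rightarrow> real^('n + 'n)^('n + 'n)" where
  "R_VBP W T \<alpha> \<gamma> = P_VBP W T \<alpha> \<gamma> - system_matrix W T"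

lemma block_matrix_mult:
  fixes A B C D A' B' C' D' :: "real^'n^'n"
  shows "block_matrix A B C D ** block_matrix A' B' C' D' =
    block_matrix (A ** A' + B ** C') (A ** B' + B ** D') (C ** A' + D ** C') (C ** B' + D ** D')"
proof -
  have "sum f (UNIV :: ('n + 'n) set) = (\<Sum>p\<in>UNIV. f (Inl p)) + (\<Sum>p\<in>UNIV. f (Inr p))"
    for f :: "'n + 'n \<Rightarrow> real"
    by (subst UNIV_Plus_UNIV[symmetric], subst sum.Plus) (auto simp: o_def)
  then show ?thesis
    by (auto simp: vec_eq_iff block_matrix_def matrix_matrix_mult_def split: sum.splits)
qed

lemma P_VBP_block:
  "P_VBP W T \<alpha> \<gamma> =
     block_matrix (T + \<alpha> *\<^sub>R mat 1 - \<gamma> *\<^sub>R (W ** W)) (- (\<gamma> *\<^sub>R (W ** T))) W T"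
  unfolding P_VBP_def block_matrix_mult
  by (simp add: vec_eq_iff block_matrix_def matrix_matrix_mult_def sum_negf sum_distrib_left
      mult.assoc mat_def if_distrib[of "\<lambda>z. _ * z"] if_distrib[of "\<lambda>z. z * _"] split: sum.splits
      cong: if_cong)

lemma R_VBP_block:
  "R_VBP W T \<alpha> \<gamma> =
     block_matrix (\<alpha> *\<^sub>R mat 1 - \<gamma> *\<^sub>R (W ** W)) (W - \<gamma> *\<^sub>R (W ** T)) 0 0"
  unfolding R_VBP_def P_VBP_block system_matrix_def
  by (simp add: vec_eq_iff block_matrix_def split: sum.splits)

definition VBP_iterates ::
  "real^'n^'n \<Rightarrow> real^'n^'n \<Rightarrow> real \<Rightarrow> real \<Rightarrow> real^('n + 'n) \<Rightarrow> real^('n + 'n) \<Rightarrow>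
     (nat \<Rightarrow> real^('n + 'n)) \<Rightarrow> bool" where
  "VBP_iterates W T \<alpha> \<gamma> d u0 U \<longleftrightarrow>
     U 0 = u0 \<and> (\<forall>k. P_VBP W T \<alpha> \<gamma> *v U (Suc k) = R_VBP W T \<alpha> \<gamma> *v U k + d)"

end

theory Submission
  imports Defs
begin

text \<open>
  The error \<open>e = (y, z)\<close> of an iterate satisfies \<open>P e' = R e\<close>, because \<open>A = P - R\<close>. The second
  block row of \<open>R\<close> vanishes, so from the first step on every error satisfies \<open>W y + T z = 0\<close>, that
  is, \<open>z = - T\<^sup>-\<^sup>1 W y\<close>. Substituting this into the first block row cancels all terms with \<open>\<gamma>\<close> and
  leaves an iteration on half of the unknowns,
  \<open>(T + \<alpha> I) y' = (\<alpha> I - S) y\<close> with \<open>S = W T\<^sup>-\<^sup>1 W\<close>.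

  Put \<open>M = T + \<alpha> I\<close> and \<open>N = \<alpha> I - S\<close>. Then \<open>M - N = T + S\<close> is positive definite since \<open>S\<close> is
  positive semidefinite, and \<open>M + N = T + 2 \<alpha> I - S\<close> is positive definite by the hypothesis
  on \<open>\<alpha>\<close>. A symmetric splitting with these two properties converges
  (\<open>P_regular_splitting_convergence\<close>): the energy \<open>y \<bullet> M y\<close> drops in each step by at
  least a fixed multiple of the squared norm of \<open>y\<close>, so these squared norms are summable. Hence
  \<open>y\<close> tends to zero, and \<open>z = - T\<^sup>-\<^sup>1 W y\<close> follows.

  That \<open>A\<close> and \<open>P\<close> are invertible, so that the limit and the iterates are well defined, comes
  from the positive definiteness of \<open>T\<close> and of \<open>T + \<alpha> I\<close>.
\<close>

section \<open>Real matrices\<close>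

lemma symmetric_matrix_inner:
  assumes "symmetric_matrix A"
  shows "x \<bullet> (A *v y) = (A *v x) \<bullet> y"
  using assms dot_lmul_matrix[of x A y] transpose_matrix_vector[of A x]
  by (simp add: symmetric_matrix_def)

lemma uminus_matrix_vector:
  fixes A :: "real^'n^'m"
  shows "(- A) *v x = - (A *v x)"
  by (simp add: vec_eq_iff matrix_vector_mult_def sum_negf)

text \<open>The constant is the minimum of the quadratic form on the compact unit sphere.\<close>

lemma pos_def_coercive:
  fixes A :: "real^'n^'n"
  assumes "symmetric_pos_def A"
  obtains m where "m > 0" "\<And>x. m * (x \<bullet> x) \<le> x \<bullet> (A *v x)"
proof -
  have "compact (sphere (0 :: real^'n) 1)" by simp
  moreover have "sphere (0 :: real^'n) 1 \<noteq> {}" by simp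
  moreover have "continuous_on (sphere (0 :: real^'n) 1) (\<lambda>x. x \<bullet> (A *v x))"
    by (intro continuous_intros matrix_vector_mult_linear_continuous_on)
  ultimately obtain w where w: "norm w = 1"
    and least: "\<And>x. norm x = 1 \<Longrightarrow> w \<bullet> (A *v w) \<le> x \<bullet> (A *v x)"
    using continuous_attains_inf[of "sphere (0 :: real^'n) 1" "\<lambda>x. x \<bullet> (A *v x)"] by auto
  show ?thesis
  proof
    show "w \<bullet> (A *v w) > 0"
      using assms w by (metis norm_zero symmetric_pos_def_def zero_neq_one)
    fix x :: "real^'n"
    show "w \<bullet> (A *v w) * (x \<bullet> x) \<le> x \<bullet> (A *v x)"
    proof (cases "x = 0")
      case False
      define s where "s = inverse (norm x)"
      have s: "s * norm x = 1" "s > 0" using False by (auto simp: s_def)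
      have "w \<bullet> (A *v w) \<le> (s *\<^sub>R x) \<bullet> (A *v (s *\<^sub>R x))"
        using s by (intro least) simp
      also have "\<dots> = s\<^sup>2 * (x \<bullet> (A *v x))"
        by (simp add: matrix_vector_mult_scaleR power2_eq_square)
      finally have "w \<bullet> (A *v w) * (norm x)\<^sup>2 \<le> s\<^sup>2 * (x \<bullet> (A *v x)) * (norm x)\<^sup>2"
        by (intro mult_right_mono) auto
      also have "\<dots> = (s * norm x)\<^sup>2 * (x \<bullet> (A *v x))"
        by (simp add: power_mult_distrib)
      finally show ?thesis using s by (simp add: power2_norm_eq_inner)
    qed simp
  qed
qed

lemma invertible_if_trivial_kernel:
  fixes A :: "real^'n^'n"
  assumes "\<And>x. A *v x = 0 \<Longrightarrow> x = 0"
  shows "invertible A"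
  using assms matrix_left_invertible_ker[of A] invertible_left_inverse[of A] by blast

lemma pos_def_invertible:
  assumes "symmetric_pos_def A"
  shows "invertible A"
  by (rule invertible_if_trivial_kernel) (metis assms inner_zero_right less_irrefl symmetric_pos_def_def)

lemma matrix_inv_inverse:
  fixes A :: "real^'n^'n"
  assumes "invertible A"
  shows "A ** matrix_inv A = mat 1" and "matrix_inv A ** A = mat 1"
  using someI_ex[OF assms[unfolded invertible_def]] by (simp_all add: matrix_inv_def)

lemma matrix_inv_cancel:
  fixes A :: "real^'n^'n"
  assumes "invertible A"
  shows "A *v (matrix_inv A *v x) = x" and "matrix_inv A *v (A *v x) = x"
  using assms by (simp_all add: matrix_vector_mul_assoc matrix_inv_inverse)

lemma symmetric_matrix_inv:
  fixes A :: "real^'n^'n"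
  assumes "symmetric_matrix A" "invertible A"
  shows "symmetric_matrix (matrix_inv A)"
proof -
  have "transpose (matrix_inv A) ** A = transpose (A ** matrix_inv A)"
    using assms(1) by (simp add: matrix_transpose_mul symmetric_matrix_def)
  then have "transpose (matrix_inv A) ** A = mat 1"
    using assms(2) by (simp add: matrix_inv_inverse transpose_mat)
  then have "transpose (matrix_inv A) ** A ** matrix_inv A = matrix_inv A"
    by simp
  then show ?thesis
    using assms(2)
    by (simp add: symmetric_matrix_def matrix_mul_assoc[symmetric] matrix_inv_inverse)
qed

section \<open>Convergence of symmetric splittings\<close>

text \<open>
  The case of symmetric matrices of the convergence theorem for \<open>P\<close>-regular splittings, in
  terms of the errors. Positive definiteness of \<open>M - N\<close> and \<open>M + N\<close> bounds the form of \<open>N\<close>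
  in absolute value strictly by that of \<open>M\<close>. By polarization this carries over to
  the mixed terms \<open>x \<bullet> N y\<close>, and for \<open>M x = N y\<close> the mixed term is the energy of \<open>x\<close>; so the
  energy decreases, without any appeal to eigenvalues or to the spectral radius of \<open>M\<^sup>-\<^sup>1 N\<close>.
\<close>

lemma P_regular_splitting_convergence:
  fixes M N :: "real^'n^'n" and e :: "nat \<Rightarrow> real^'n"
  assumes N: "symmetric_matrix N"
    and minus: "symmetric_pos_def (M - N)" and plus: "symmetric_pos_def (M + N)"
    and step: "\<And>k. M *v e (Suc k) = N *v e k"
  shows "e \<longlonglongrightarrow> 0"
proof -
  obtain m1 where m1: "m1 > 0" "\<And>x. m1 * (x \<bullet> x) \<le> x \<bullet> ((M - N) *v x)"
    using pos_def_coercive[OF minus] by blast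
  obtain m2 where m2: "m2 > 0" "\<And>x. m2 * (x \<bullet> x) \<le> x \<bullet> ((M + N) *v x)"
    using pos_def_coercive[OF plus] by blast
  define m where "m = min m1 m2"
  define q where "q x = x \<bullet> (M *v x)" for x
  have m: "m > 0" using m1 m2 by (simp add: m_def)
  have "m * (x \<bullet> x) \<le> m1 * (x \<bullet> x)" "m * (x \<bullet> x) \<le> m2 * (x \<bullet> x)" for x :: "real^'n"
    by (auto simp: m_def intro!: mult_right_mono)
  then have up: "x \<bullet> (N *v x) \<le> q x - m * (x \<bullet> x)"
    and low: "- (x \<bullet> (N *v x)) \<le> q x - m * (x \<bullet> x)" for x
    using m1(2)[of x] m2(2)[of x]
    by (smt (verit) q_def inner_right_distrib inner_diff_right
        matrix_vector_mult_add_rdistrib matrix_vector_mult_diff_rdistrib)+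
  have q_nonneg: "q x \<ge> 0" for x
    using up[of x] low[of x] m inner_ge_zero[of x]
    by (smt (verit) mult_nonneg_nonneg)
  have decrease: "m * (y \<bullet> y) \<le> q y - q x" if xy: "M *v x = N *v y" for x y
  proof -
    \<comment> \<open>Polarization, then the two bounds, then the parallelogram law for \<open>q\<close> and the norm.\<close>
    have "4 * (x \<bullet> (N *v y)) =
        (x + y) \<bullet> (N *v (x + y)) - (x - y) \<bullet> (N *v (x - y))"
      using symmetric_matrix_inner[OF N, of y x]
      by (simp add: algebra_simps inner_commute matrix_vector_mult_diff_distrib
          matrix_vector_right_distrib)
    also have "\<dots> \<le> (q (x + y) - m * ((x + y) \<bullet> (x + y))) + (q (x - y) - m * ((x - y) \<bullet> (x - y)))"
      using up[of "x + y"] low[of "x - y"] by linarith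
    also have "\<dots> = 2 * q x + 2 * q y - 2 * m * (x \<bullet> x) - 2 * m * (y \<bullet> y)"
      unfolding q_def
      by (simp add: algebra_simps matrix_vector_mult_diff_distrib
          matrix_vector_right_distrib)
    finally have "2 * q x \<le> 2 * q y - 2 * m * (x \<bullet> x) - 2 * m * (y \<bullet> y)"
      by (simp add: q_def xy)
    moreover have "m * (x \<bullet> x) \<ge> 0" using m by simp
    ultimately show ?thesis by linarith
  qed
  have "(\<Sum>k<n. m * (e k \<bullet> e k)) \<le> q (e 0) - q (e n)" for n
  proof (induction n)
    case (Suc n)
    then show ?case using decrease[OF step[of n]] by simp
  qed simp
  then have "(\<Sum>k<n. m * (e k \<bullet> e k)) \<le> q (e 0)" for n
    using q_nonneg[of "e n"] by (smt (verit))
  then have "summable (\<lambda>k. m * (e k \<bullet> e k))"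
    using m by (intro summableI_nonneg_bounded) auto
  then have "(\<lambda>k. e k \<bullet> e k) \<longlonglongrightarrow> 0"
    using m summable_LIMSEQ_zero[of "\<lambda>k. e k \<bullet> e k"] by (simp add: summable_cmult_iff)
  then have "(\<lambda>k. norm (e k)) \<longlonglongrightarrow> 0"
    using tendsto_real_sqrt[of "\<lambda>k. e k \<bullet> e k" 0] by (simp add: norm_eq_sqrt_inner)
  then show ?thesis by (rule tendsto_norm_zero_cancel)
qed

section \<open>Block vectors\<close>

definition upper_part :: "'a^('n::finite + 'k::finite) \<Rightarrow> 'a^'n" where
  "upper_part v = (\<chi> i. v $ Inl i)"

definition lower_part :: "'a^('n::finite + 'k::finite) \<Rightarrow> 'a^'k" where
  "lower_part v = (\<chi> i. v $ Inr i)"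

lemma parts_eq_iff:
  "v = w \<longleftrightarrow> upper_part v = upper_part w \<and> lower_part v = lower_part w"
proof -
  have "(\<forall>i. v $ i = w $ i) \<longleftrightarrow> (\<forall>i. v $ Inl i = w $ Inl i) \<and> (\<forall>i. v $ Inr i = w $ Inr i)"
    by (metis sum.exhaust)
  then show ?thesis by (simp add: vec_eq_iff upper_part_def lower_part_def)
qed

lemma parts_zero [simp]:
  "upper_part (0 :: 'a::zero^('n::finite + 'k::finite)) = 0" "lower_part (0 :: 'a::zero^('n::finite + 'k::finite)) = 0"
  by (simp_all add: vec_eq_iff upper_part_def lower_part_def)

lemma parts_block_matrix_vector:
  fixes A :: "real^'n^'m" and B :: "real^'k^'m" and C :: "real^'n^'l" and D :: "real^'k^'l"
  shows "upper_part (block_matrix A B C D *v v) = A *v upper_part v + B *v lower_part v"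
    and "lower_part (block_matrix A B C D *v v) = C *v upper_part v + D *v lower_part v"
proof -
  have "sum f (UNIV :: ('n + 'k) set) = (\<Sum>p\<in>UNIV. f (Inl p)) + (\<Sum>p\<in>UNIV. f (Inr p))"
    for f :: "'n + 'k \<Rightarrow> real"
    by (subst UNIV_Plus_UNIV[symmetric], subst sum.Plus) (auto simp: o_def)
  then show "upper_part (block_matrix A B C D *v v) = A *v upper_part v + B *v lower_part v"
    and "lower_part (block_matrix A B C D *v v) = C *v upper_part v + D *v lower_part v"
    by (simp_all add: vec_eq_iff upper_part_def lower_part_def block_matrix_def
        matrix_vector_mult_def)
qed

lemma parts_tendsto_zero:
  fixes f :: "nat \<Rightarrow> real^('n::finite + 'k::finite)"
  assumes "(\<lambda>k. upper_part (f k)) \<longlonglongrightarrow> 0" "(\<lambda>k. lower_part (f k)) \<longlonglongrightarrow> 0"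
  shows "f \<longlonglongrightarrow> 0"
proof (rule vec_tendstoI)
  fix i :: "'n + 'k"
  show "(\<lambda>k. f k $ i) \<longlonglongrightarrow> 0 $ i"
    using tendsto_vec_nth[OF assms(1)] tendsto_vec_nth[OF assms(2)]
    by (cases i) (auto simp: upper_part_def lower_part_def)
qed

section \<open>Invertibility of the system and of the preconditioner\<close>

text \<open>
  In the quadratic form of the system matrix at \<open>(y, z)\<close> the two terms with \<open>W\<close> cancel,
  since \<open>W\<close> is symmetric; only \<open>y \<bullet> T y + z \<bullet> T z\<close> remains.
\<close>

lemma system_matrix_invertible:
  assumes W: "symmetric_matrix W" and T: "symmetric_pos_def T"
  shows "invertible (system_matrix W T)"
proof (rule invertible_if_trivial_kernel)
  fix v assume v: "system_matrix W T *v v = 0"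
  define y z where "y = upper_part v" and "z = lower_part v"
  have eqs: "T *v y - W *v z = 0" "W *v y + T *v z = 0"
    using v parts_block_matrix_vector[of T "- W" W T v]
    by (simp_all add: system_matrix_def y_def z_def uminus_matrix_vector)
  have "y \<bullet> (T *v y - W *v z) + z \<bullet> (W *v y + T *v z) = 0"
    by (simp only: eqs inner_zero_right)
  then have "y \<bullet> (T *v y) + z \<bullet> (T *v z) = 0"
    using symmetric_matrix_inner[OF W, of y z]
    by (simp add: inner_diff_right inner_add_right inner_commute)
  moreover have "x \<bullet> (T *v x) > 0" if "x \<noteq> 0" for x
    using that T by (simp add: symmetric_pos_def_def)
  ultimately have "y = 0 \<and> z = 0"
    by (smt (verit) inner_zero_left)
  then show "v = 0" by (simp add: parts_eq_iff y_def z_def)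
qed

text \<open>
  The factored form of the preconditioner is kept here: the combination \<open>W y + T z\<close>, which
  vanishes on the errors, then appears in both block rows.
\<close>

lemma P_VBP_parts:
  "upper_part (P_VBP W T \<alpha> \<gamma> *v v) = T *v upper_part v + \<alpha> *\<^sub>R upper_part v
     - \<gamma> *\<^sub>R (W *v (W *v upper_part v + T *v lower_part v))"
  "lower_part (P_VBP W T \<alpha> \<gamma> *v v) = W *v upper_part v + T *v lower_part v"
  by (simp_all add: P_VBP_def matrix_vector_mul_assoc[symmetric] parts_block_matrix_vector
      matrix_vector_mult_add_rdistrib uminus_matrix_vector scaleR_matrix_vector_assoc[symmetric])

lemma P_VBP_invertible:
  assumes T: "symmetric_pos_def T" and "\<alpha> > 0"
  shows "invertible (P_VBP W T \<alpha> \<gamma>)"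
proof (rule invertible_if_trivial_kernel)
  fix v assume v: "P_VBP W T \<alpha> \<gamma> *v v = 0"
  have low: "W *v upper_part v + T *v lower_part v = 0"
    using P_VBP_parts(2)[of W T \<alpha> \<gamma> v] v by simp
  have up: "T *v upper_part v + \<alpha> *\<^sub>R upper_part v = 0"
    using P_VBP_parts(1)[of W T \<alpha> \<gamma> v] v low by simp
  have pos: "x \<bullet> (T *v x) > 0" if "x \<noteq> 0" for x
    using that T by (simp add: symmetric_pos_def_def)
  have "upper_part v \<bullet> (T *v upper_part v) + \<alpha> * (upper_part v \<bullet> upper_part v) = 0"
    using arg_cong[OF up, of "\<lambda>w. upper_part v \<bullet> w"] by (simp add: inner_add_right)
  moreover have "\<alpha> * (upper_part v \<bullet> upper_part v) \<ge> 0" using \<open>\<alpha> > 0\<close> by simp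
  ultimately have y: "upper_part v = 0" using pos[of "upper_part v"] by fastforce
  then have "T *v lower_part v = 0" using low by simp
  then have "lower_part v = 0" using pos[of "lower_part v"] by fastforce
  with y show "v = 0" by (simp add: parts_eq_iff)
qed

lemma VBP_iterates_ex1:
  assumes "invertible (P_VBP W T \<alpha> \<gamma>)"
  shows "\<exists>!U. VBP_iterates W T \<alpha> \<gamma> d u0 U"
proof -
  define g where "g u = matrix_inv (P_VBP W T \<alpha> \<gamma>) *v (R_VBP W T \<alpha> \<gamma> *v u + d)" for u
  have "P_VBP W T \<alpha> \<gamma> *v u' = R_VBP W T \<alpha> \<gamma> *v u + d \<longleftrightarrow> u' = g u" for u u'
    using matrix_inv_cancel[OF assms] unfolding g_def by metis
  then have iff: "VBP_iterates W T \<alpha> \<gamma> d u0 U \<longleftrightarrow> U 0 = u0 \<and> (\<forall>k. U (Suc k) = g (U k))" for U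
    by (simp add: VBP_iterates_def)
  show ?thesis
  proof
    show "VBP_iterates W T \<alpha> \<gamma> d u0 (rec_nat u0 (\<lambda>_. g))" by (simp add: iff)
    fix U assume U: "VBP_iterates W T \<alpha> \<gamma> d u0 U"
    have "U k = rec_nat u0 (\<lambda>_. g) k" for k
      using U by (induction k) (simp_all add: iff)
    then show "U = rec_nat u0 (\<lambda>_. g)" by blast
  qed
qed

section \<open>Propagation of the error\<close>

text \<open>
  The Schur complement of the lower right block in the system matrix is \<open>T + schur_term W T\<close>.
\<close>

definition schur_term :: "real^'n^'n \<Rightarrow> real^'n^'n \<Rightarrow> real^'n^'n" where
  "schur_term W T = W ** matrix_inv T ** W"

lemma symmetric_schur_term:
  fixes W T :: "real^'n^'n"
  assumes "symmetric_matrix W" "symmetric_pos_def T"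
  shows "symmetric_matrix (schur_term W T)"
proof -
  have "symmetric_matrix (matrix_inv T)"
    using assms(2) symmetric_matrix_inv[of T] pos_def_invertible[of T]
    by (simp add: symmetric_pos_def_def)
  then show ?thesis
    using assms(1)
    by (simp add: schur_term_def symmetric_matrix_def matrix_transpose_mul matrix_mul_assoc)
qed

text \<open>With \<open>w = T\<^sup>-\<^sup>1 W x\<close> the form equals \<open>w \<bullet> T w\<close>.\<close>

lemma schur_term_nonneg:
  fixes W T :: "real^'n^'n"
  assumes "symmetric_matrix W" "symmetric_pos_def T"
  shows "x \<bullet> (schur_term W T *v x) \<ge> 0"
proof -
  define w where "w = matrix_inv T *v (W *v x)"
  have T: "symmetric_matrix T" and pos: "w \<noteq> 0 \<Longrightarrow> w \<bullet> (T *v w) > 0"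
    using assms(2) by (auto simp: symmetric_pos_def_def)
  have "x \<bullet> (schur_term W T *v x) = (W *v x) \<bullet> w"
    using symmetric_matrix_inner[OF assms(1)]
    by (simp add: schur_term_def w_def matrix_vector_mul_assoc[symmetric])
  also have "\<dots> = w \<bullet> (T *v w)"
    using matrix_inv_cancel(1)[OF pos_def_invertible[OF assms(2)]]
    by (simp add: w_def inner_commute)
  also have "\<dots> \<ge> 0" using pos by (cases "w = 0") auto
  finally show ?thesis .
qed

lemma VBP_error_constraint:
  assumes "P_VBP W T \<alpha> \<gamma> *v e' = R_VBP W T \<alpha> \<gamma> *v e"
  shows "W *v upper_part e' + T *v lower_part e' = 0"
  using P_VBP_parts(2)[of W T \<alpha> \<gamma> e'] assms by (simp add: R_VBP_block parts_block_matrix_vector)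

text \<open>
  In the first block row \<open>\<gamma>\<close> occurs only as a factor of \<open>W (W y + T z)\<close>, on the left as well as
  on the right, so it disappears on the subspace \<open>W y + T z = 0\<close>. Eliminating \<open>z\<close> there turns
  the term \<open>W z\<close> of the right-hand side into \<open>- W T\<^sup>-\<^sup>1 W y\<close>.
\<close>

lemma VBP_upper_error_step:
  fixes W T :: "real^'n^'n"
  assumes T: "invertible T"
    and step: "P_VBP W T \<alpha> \<gamma> *v e' = R_VBP W T \<alpha> \<gamma> *v e"
    and e: "W *v upper_part e + T *v lower_part e = 0"
  shows "(T + \<alpha> *\<^sub>R mat 1) *v upper_part e' = (\<alpha> *\<^sub>R mat 1 - schur_term W T) *v upper_part e"
proof -
  define y z where "y = upper_part e" and "z = lower_part e"
  have Re: "upper_part (R_VBP W T \<alpha> \<gamma> *v e) = \<alpha> *\<^sub>R y - \<gamma> *\<^sub>R (W *v (W *v y + T *v z)) + W *v z"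
    by (simp add: R_VBP_block parts_block_matrix_vector y_def z_def
        matrix_vector_mult_diff_rdistrib scaleR_matrix_vector_assoc[symmetric]
        matrix_vector_mul_assoc[symmetric] matrix_vector_right_distrib scaleR_right_distrib)
  have "T *v z = - (W *v y)"
    using e by (simp add: y_def z_def eq_neg_iff_add_eq_0 add.commute)
  then have z: "z = - (matrix_inv T *v (W *v y))"
    using matrix_inv_cancel(2)[OF T, of z] by (metis linear_neg matrix_vector_mul_linear)
  have "T *v upper_part e' + \<alpha> *\<^sub>R upper_part e' = \<alpha> *\<^sub>R y + W *v z"
    using P_VBP_parts(1)[of W T \<alpha> \<gamma> e'] step Re e VBP_error_constraint[OF step] by (simp add: y_def z_def)
  also have "W *v z = - (schur_term W T *v y)"
    unfolding z schur_term_def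
    by (metis linear_neg matrix_vector_mul_linear matrix_vector_mul_assoc)
  finally show "(T + \<alpha> *\<^sub>R mat 1) *v upper_part e' = (\<alpha> *\<^sub>R mat 1 - schur_term W T) *v upper_part e"
    by (simp add: y_def matrix_vector_mult_add_rdistrib matrix_vector_mult_diff_rdistrib
        scaleR_matrix_vector_assoc[symmetric])
qed

text \<open>
  The initial error need not satisfy \<open>W y + T z = 0\<close>, so the splitting argument runs on the
  sequence shifted by one.
\<close>

lemma VBP_error_tendsto_zero:
  fixes W T :: "real^'n^'n"
  assumes W: "symmetric_matrix W" and T: "symmetric_pos_def T" and "\<alpha> > 0"
    and bound: "\<And>x. norm x = 1 \<Longrightarrow>
      x \<bullet> (schur_term W T *v x) - x \<bullet> (T *v x) < 2 * \<alpha>"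
    and step: "\<And>k. P_VBP W T \<alpha> \<gamma> *v e (Suc k) = R_VBP W T \<alpha> \<gamma> *v e k"
  shows "e \<longlonglongrightarrow> 0"
proof -
  define S where "S = schur_term W T"
  define M N where "M = T + \<alpha> *\<^sub>R mat 1" and "N = \<alpha> *\<^sub>R mat 1 - S"
  note Tinv = pos_def_invertible[OF T]
  have Tsym: "symmetric_matrix T" using T by (simp add: symmetric_pos_def_def)
  have Ssym: "symmetric_matrix S" using symmetric_schur_term[OF W T] by (simp add: S_def)
  have sym: "symmetric_matrix N" "symmetric_matrix (M - N)" "symmetric_matrix (M + N)"
    using Tsym Ssym
    by (auto simp: symmetric_matrix_def M_def N_def vec_eq_iff transpose_def mat_def)
  have minus: "symmetric_pos_def (M - N)"
    unfolding symmetric_pos_def_def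
  proof (intro conjI allI impI sym)
    fix x :: "real^'n" assume "x \<noteq> 0"
    then have "x \<bullet> (T *v x) > 0" using T by (simp add: symmetric_pos_def_def)
    then show "x \<bullet> ((M - N) *v x) > 0"
      using schur_term_nonneg[OF W T, of x]
      by (simp add: M_def N_def S_def matrix_vector_mult_add_rdistrib inner_add_right)
  qed
  have plus: "symmetric_pos_def (M + N)"
    unfolding symmetric_pos_def_def
  proof (intro conjI allI impI sym)
    fix x :: "real^'n" assume "x \<noteq> 0"
    define w where "w = x /\<^sub>R norm x"
    have w: "norm w = 1" "x = norm x *\<^sub>R w" using \<open>x \<noteq> 0\<close> by (simp_all add: w_def)
    have "w \<bullet> w = 1" using w(1) by (simp add: norm_eq_1)
    moreover have "(M + N) *v w = (T *v w + \<alpha> *\<^sub>R w) + (\<alpha> *\<^sub>R w - S *v w)"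
      unfolding matrix_vector_mult_add_rdistrib[of M N]
      by (simp add: M_def N_def matrix_vector_mult_add_rdistrib matrix_vector_mult_diff_rdistrib
          scaleR_matrix_vector_assoc[symmetric])
    ultimately have "w \<bullet> ((M + N) *v w) = w \<bullet> (T *v w) + 2 * \<alpha> - w \<bullet> (S *v w)"
      by (simp only: inner_add_right inner_diff_right inner_scaleR_right)
    then have "w \<bullet> ((M + N) *v w) > 0" using bound[OF w(1)] by (simp add: S_def)
    moreover have "x \<bullet> ((M + N) *v x) = (norm x)\<^sup>2 * (w \<bullet> ((M + N) *v w))"
      by (subst (1 2) w(2)) (simp add: matrix_vector_mult_scaleR power2_eq_square)
    ultimately show "x \<bullet> ((M + N) *v x) > 0" using \<open>x \<noteq> 0\<close> by simp
  qed
  have low: "W *v upper_part (e (Suc k)) + T *v lower_part (e (Suc k)) = 0" for k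
    by (rule VBP_error_constraint[OF step])
  have "M *v upper_part (e (Suc (Suc k))) = N *v upper_part (e (Suc k))" for k
    using VBP_upper_error_step[OF Tinv step low] by (simp add: M_def N_def S_def)
  then have y: "(\<lambda>k. upper_part (e (Suc k))) \<longlonglongrightarrow> 0"
    by (intro P_regular_splitting_convergence[OF sym(1) minus plus])
  have "lower_part (e (Suc k)) = - (matrix_inv T *v (W *v upper_part (e (Suc k))))" for k
  proof -
    have "T *v lower_part (e (Suc k)) = - (W *v upper_part (e (Suc k)))"
      using low[of k] by (simp add: eq_neg_iff_add_eq_0 add.commute)
    then show ?thesis
      using matrix_inv_cancel(2)[OF Tinv] by (metis linear_neg matrix_vector_mul_linear)
  qed
  moreover have "(\<lambda>k. - (matrix_inv T *v (W *v upper_part (e (Suc k))))) \<longlonglongrightarrow>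
      - (matrix_inv T *v (W *v 0))"
    by (intro tendsto_minus bounded_linear.tendsto[OF matrix_vector_mul_bounded_linear] y)
  ultimately have "(\<lambda>k. lower_part (e (Suc k))) \<longlonglongrightarrow> 0" by simp
  with y have "(\<lambda>k. e (Suc k)) \<longlonglongrightarrow> 0" by (rule parts_tendsto_zero)
  then show ?thesis by (rule LIMSEQ_imp_Suc)
qed

section \<open>Convergence of the VBP iteration\<close>

text \<open>
  The bound on \<open>\<alpha>\<close> is stated for complex unit vectors, while the argument above works
  over the reals; these two facts specialize the bound to real unit vectors.
\<close>

lemma herm_form_of_real:
  "herm_form A (\<chi> i. complex_of_real (x $ i)) = complex_of_real (x \<bullet> (A *v x))"
  by (simp add: herm_form_def matrix_vector_mult_def inner_vec_def)

lemma norm_of_real_vec: "norm (\<chi> i. complex_of_real (x $ i)) = norm x"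
  by (simp add: norm_vec_def L2_set_def)

theorem theorem1:
  fixes W T :: "real^'n^'n" and \<alpha> \<gamma> :: real
  assumes "symmetric_indefinite W"
    and "symmetric_pos_def T"
    and "\<alpha> > 0" and "\<gamma> > 0"
    and "\<And>x :: complex^'n. norm x = 1 \<Longrightarrow>
           \<alpha> > (Re (herm_form (W ** matrix_inv T ** W) x) - Re (herm_form T x)) / 2"
  shows "\<forall>d :: real^('n + 'n).
           \<exists>u. (\<forall>v. system_matrix W T *v v = d \<longleftrightarrow> v = u) \<and>
               (\<forall>u0. (\<exists>!U. VBP_iterates W T \<alpha> \<gamma> d u0 U) \<and>
                     (\<forall>U. VBP_iterates W T \<alpha> \<gamma> d u0 U \<longrightarrow> U \<longlonglongrightarrow> u))"
proof
  fix d :: "real^('n + 'n)"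
  have W: "symmetric_matrix W"
    using assms(1) by (simp add: symmetric_indefinite_def)
  have bound: "x \<bullet> (schur_term W T *v x) - x \<bullet> (T *v x) < 2 * \<alpha>" if "norm x = 1" for x :: "real^'n"
    using assms(5)[of "\<chi> i. complex_of_real (x $ i)"] that
    by (simp add: norm_of_real_vec herm_form_of_real schur_term_def)
  define u where "u = matrix_inv (system_matrix W T) *v d"
  have u: "system_matrix W T *v v = d \<longleftrightarrow> v = u" for v
    using matrix_inv_cancel[OF system_matrix_invertible[OF W assms(2)]] unfolding u_def by metis
  have "U \<longlonglongrightarrow> u" if U: "VBP_iterates W T \<alpha> \<gamma> d u0 U" for u0 U
  proof -
    have "P_VBP W T \<alpha> \<gamma> *v u - R_VBP W T \<alpha> \<gamma> *v u = d"
      using u[of u] by (simp add: R_VBP_def matrix_vector_mult_diff_rdistrib)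
    then have "P_VBP W T \<alpha> \<gamma> *v (U (Suc k) - u) = R_VBP W T \<alpha> \<gamma> *v (U k - u)" for k
      using U by (auto simp: VBP_iterates_def matrix_vector_mult_diff_distrib algebra_simps)
    then have "(\<lambda>k. U k - u) \<longlonglongrightarrow> 0"
      by (intro VBP_error_tendsto_zero[OF W assms(2,3) bound])
    then show ?thesis by (simp add: LIM_zero_iff)
  qed
  then show "\<exists>u. (\<forall>v. system_matrix W T *v v = d \<longleftrightarrow> v = u) \<and>
               (\<forall>u0. (\<exists>!U. VBP_iterates W T \<alpha> \<gamma> d u0 U) \<and>
                     (\<forall>U. VBP_iterates W T \<alpha> \<gamma> d u0 U \<longrightarrow> U \<longlonglongrightarrow> u))"
    using u VBP_iterates_ex1[OF P_VBP_invertible[OF assms(2,3)]] by blast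
qed

end
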